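(* Let $\mathbb K$ be $\mathbb R$ or $\mathbb C$, let $G\subseteq GL(n,\mathbb K)$ be a linear algebraic group acting naturally on $\mathbb K^n$, and let $V\subseteq\mathbb K^n$ be an irreducible affine variety with $T(V)=V$ for all $T\in G$. Assume that the invariant algebra $\mathbb K[V]^G$ is finitely generated, with generators $\gamma_1,\ldots,\gamma_r$, and let $\Gamma=(\gamma_1,\ldots,\gamma_r)^{\rm tr}:V\to\mathbb K^r$ be the corresponding Hilbert map. Let $I\subseteq\mathbb K[x_1,\ldots,x_r]$ be the ideal of relations between the $\gamma_i$, and let $Y\subseteq\mathbb K^r$ be the vanishing set of $I$ (so that $I=J(Y)$, $\mathbb K[Y]=\mathbb K[x_1,\ldots,x_r]/I$, and $Y$ is the Zariski closure of $\Gamma(V)$). Assume that $\{\cdot,\cdot\}$ is a Poisson bracket on $V$ which is $G$-invariant, i.e. the identity $\{\phi\circ T,\psi\circ T\}=\{\phi,\psi\}\circ T$ holds in $\mathbb K[V]$ for all $\phi,\psi\in\mathbb K[V]$ and all $T\in G$. (a) Let $\phi,\psi\in\mathbb K[V]^G$ and let $\widetilde\phi,\widetilde\psi\in\mathbb K[x_1,\ldots,x_r]/I$ be such that $\phi=\widetilde\phi\circ\Gamma$ and $\psi=\widetilde\psi\circ\Gamma$. Then there exists a uniquely determined $\{\widetilde\phi,\widetilde\psi\}'\in\mathbb K[x_1,\ldots,x_r]/I=\mathbb K[Y]$ such that $$\{\phi,\psi\}=\{\widetilde\phi,\widetilde\psi\}'\circ\Gamma .$$ (b) The identity $\{\phi,\psi\}=\{\widetilde\phi,\widetilde\psi\}'\circ\Gamma$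 defines a Poisson bracket $\{\cdot,\cdot\}'$ on $Y$. The Hilbert map $\Gamma$ sends Hamiltonian $G$-equivariant vector fields on $V$ to vector fields on $Y$ that are Hamiltonian with respect to $\{\cdot,\cdot\}'$. Moreover, Casimir elements of $(V,\{\cdot,\cdot\})$ are sent to Casimir elements of $(Y,\{\cdot,\cdot\}')$.
   Context: A variety $V\subseteq\mathbb K^n$ is the common zero set of a family of polynomials; $J(V)$ is the ideal of all polynomials in $\mathbb K[x_1,\ldots,x_n]$ vanishing on $V$; $\mathbb K[V]\cong\mathbb K[x_1,\ldots,x_n]/J(V)$ is the algebra of regular functions (restrictions of polynomials to $V$). The Zariski-closed sets are the varieties; $V$ is irreducible if it is not the union of two proper Zariski-closed subsets. $\mathbb K[V]^G$ is the subalgebra of all $\phi\in\mathbb K[V]$ with $\phi\circ T=\phi$ for all $T\in G$. The ideal of relations is $I=\{\psi\in\mathbb K[x_1,\ldots,x_r]:\psi(\gamma_1,\ldots,\gamma_r)=0\}$, where the $\gamma_i$ are regarded as elements of $\mathbb K[V]$. A Poisson bracket on a variety $V$ is a skew-symmetric bilinear map $\{\cdot,\cdot\}:\mathbb K[V]\times\mathbb K[V]\to\mathbb K[V]$ satisfying the Leibniz rule and the Jacobi identity. If $\gamma_{ij}$ are polynomials with $\{x_i+J(V),x_j+J(V)\}=\gamma_{ij}+J(V)$, then $\{\phi+J(V),\psi+J(V)\}=\sum_{i,j}\gamma_{ij}\frac{\partial\phi}{\partial x_i}\frac{\partial\psi}{\partial x_j}+J(V)$, and the Hamiltonian vector field of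 $\phi+J(V)$ is the vector field given by the polynomial map $\left(\sum_i\gamma_{ij}\frac{\partial\phi}{\partial x_i}\right)_{1\le j\le n}$, whose Lie derivative sends $J(V)$ to itself. Hamiltonian vector fields on $Y$ with respect to $\{\cdot,\cdot\}'$ are defined in the same way. A polynomial vector field $f$ on $V$ (determined only up to elements of $J(V)^n$) is $G$-equivariant (also called $G$-symmetric) if $Tf(y)=f(Ty)$ for all $T\in G$ and $y\in V$. The Hilbert map $\Gamma$ sends a vector field $f$ on $V$ to a vector field $g$ on $Y$ if $D\Gamma(x)f(x)=g(\Gamma(x))$ holds on $V$. A Casimir element of a Poisson bracket is a regular function whose bracket with every regular function vanishes; for functions, "sent to" refers to the correspondence between $\phi$ and $\widetilde\phi$ given by $\phi=\widetilde\phi\circ\Gamma$.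
   Formalization: In (b) the G-equivariant Hamiltonian fields are required to have a Hamiltonian function in K[V]^G; without this the claim fails, e.g. for x1 -> x1+t*x3 on V={x3=1} with {x1,x2}=1 and the field of x1. *)

theory Defs
  imports "HOL-Analysis.Analysis" "HOL-Library.Poly_Mapping" "HOL-Library.FuncSet"
begin

text \<open>
  The polynomial ring in the indeterminates indexed by \<open>'v\<close> is the monoid algebra of
  \<open>'v \<Rightarrow>\<^sub>0 nat\<close>; its ring operations are those of \<^theory>\<open>HOL-Library.Poly_Mapping\<close>.
  Affine \<open>n\<close>-space is \<open>'k ^ 'n\<close>.  In the final theorem \<open>'k\<close> is a \<^class>\<open>real_normed_field\<close>;
  by the Gelfand-Mazur theorem these are, up to isomorphism, exactly the reals and the
  complex numbers.
\<close>

type_synonym ('v, 'a) mpoly = "('v \<Rightarrow>\<^sub>0 nat) \<Rightarrow>\<^sub>0 'a"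

definition mvar :: "'v \<Rightarrow> ('v, 'a::comm_ring_1) mpoly" where
  "mvar i = Poly_Mapping.single (Poly_Mapping.single i 1) 1"

definition mderiv :: "'v \<Rightarrow> ('v, 'a::comm_ring_1) mpoly \<Rightarrow> ('v, 'a) mpoly" where
  "mderiv i p = (\<Sum>m\<in>Poly_Mapping.keys p.
     Poly_Mapping.single (m - Poly_Mapping.single i 1)
       (Poly_Mapping.lookup p m * of_nat (Poly_Mapping.lookup m i)))"

definition meval :: "('v, 'a::comm_ring_1) mpoly \<Rightarrow> ('v \<Rightarrow> 'a) \<Rightarrow> 'a" where
  "meval p x = (\<Sum>m\<in>Poly_Mapping.keys p. Poly_Mapping.lookup p m *
     (\<Prod>i\<in>Poly_Mapping.keys m. x i ^ Poly_Mapping.lookup m i))"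

definition peval :: "('n, 'k) mpoly \<Rightarrow> 'k::field ^ 'n::finite \<Rightarrow> 'k" where
  "peval p x = meval p (\<lambda>i. x $ i)"

definition zero_set :: "('n, 'k) mpoly set \<Rightarrow> ('k::field ^ 'n::finite) set" where
  "zero_set F = {x. \<forall>p\<in>F. peval p x = 0}"

definition variety :: "('k::field ^ 'n::finite) set \<Rightarrow> bool" where
  "variety V \<longleftrightarrow> (\<exists>F. V = zero_set F)"

definition vanishing_ideal :: "('k::field ^ 'n::finite) set \<Rightarrow> ('n, 'k) mpoly set" where
  "vanishing_ideal V = {p. \<forall>x\<in>V. peval p x = 0}"

definition irreducible_variety :: "('k::field ^ 'n::finite) set \<Rightarrow> bool" where
  "irreducible_variety V \<longleftrightarrow> variety V \<and>
     \<not> (\<exists>A B. variety A \<and> variety B \<and> A \<subset> V \<and> B \<subset> V \<and> V = A \<union> B)"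

definition linear_algebraic_group :: "('k::field ^ 'n::finite ^ 'n) set \<Rightarrow> bool" where
  "linear_algebraic_group G \<longleftrightarrow>
     (\<exists>F :: ('n \<times> 'n, 'k) mpoly set.
        G = {T. invertible T \<and> (\<forall>p\<in>F. meval p (\<lambda>(i, j). T $ i $ j) = 0)}) \<and>
     mat 1 \<in> G \<and> (\<forall>S\<in>G. \<forall>T\<in>G. S ** T \<in> G) \<and> (\<forall>T\<in>G. matrix_inv T \<in> G)"

text \<open>
  The class of \<open>p\<close> in the coordinate ring of \<open>V\<close> is the restriction of \<open>p\<close> to \<open>V\<close>, an
  extensional function; so equality of classes modulo \<open>vanishing_ideal V\<close> is equality in HOL.
\<close>

definition regf :: "('k::field ^ 'n::finite) set \<Rightarrow> ('n, 'k) mpoly \<Rightarrow> 'k ^ 'n \<Rightarrow> 'k" where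
  "regf V p = restrict (peval p) V"

definition coord_ring :: "('k::field ^ 'n::finite) set \<Rightarrow> ('k ^ 'n \<Rightarrow> 'k) set" where
  "coord_ring V = range (regf V)"

lemma regf_eq_iff_diff:
  "regf V p = regf V q \<longleftrightarrow> p - q \<in> vanishing_ideal V"
proof -
  have minus: "meval (p - q) x = meval p x - meval q x" for x
  proof -
    let ?K = "Poly_Mapping.keys p \<union> Poly_Mapping.keys q"
    let ?t = "\<lambda>m. \<Prod>i\<in>Poly_Mapping.keys m. x i ^ Poly_Mapping.lookup m i"
    have ev: "meval s x = (\<Sum>m\<in>?K. Poly_Mapping.lookup s m * ?t m)"
      if "Poly_Mapping.keys s \<subseteq> ?K" for s
      unfolding meval_def using that
      by (intro sum.mono_neutral_left) (auto simp: in_keys_iff)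
    have "Poly_Mapping.keys (p - q) \<subseteq> ?K"
      by (auto simp: in_keys_iff lookup_minus)
    then show ?thesis
      by (simp add: ev lookup_minus algebra_simps sum_subtractf)
  qed
  have "regf V p = regf V q \<longleftrightarrow> (\<forall>x\<in>V. peval p x = peval q x)"
    unfolding regf_def by (metis restrict_apply' restrict_ext)
  then show ?thesis
    by (simp add: vanishing_ideal_def peval_def minus)
qed

definition act :: "('k::field ^ 'n::finite) set \<Rightarrow> 'k ^ 'n ^ 'n \<Rightarrow> ('k ^ 'n \<Rightarrow> 'k) \<Rightarrow> 'k ^ 'n \<Rightarrow> 'k" where
  "act V T \<phi> = (\<lambda>x\<in>V. \<phi> (T *v x))"

definition invariant_ring :: "('k::field ^ 'n::finite ^ 'n) set \<Rightarrow> ('k ^ 'n) set \<Rightarrow> ('k ^ 'n \<Rightarrow> 'k) set" where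
  "invariant_ring G V = {\<phi> \<in> coord_ring V. \<forall>T\<in>G. act V T \<phi> = \<phi>}"

definition hilbert_map :: "('r::finite \<Rightarrow> ('n, 'k) mpoly) \<Rightarrow> 'k::field ^ 'n::finite \<Rightarrow> 'k ^ 'r" where
  "hilbert_map \<gamma> x = (\<chi> i. peval (\<gamma> i) x)"

definition pullback ::
  "('k::field ^ 'n::finite) set \<Rightarrow> ('r::finite \<Rightarrow> ('n, 'k) mpoly) \<Rightarrow> ('k ^ 'r \<Rightarrow> 'k) \<Rightarrow> 'k ^ 'n \<Rightarrow> 'k" where
  "pullback V \<gamma> a = (\<lambda>x\<in>V. a (hilbert_map \<gamma> x))"

text \<open>\<open>pullback V \<gamma> (peval q)\<close> is the element \<open>q(\<gamma>\<^sub>1, \<dots>, \<gamma>\<^sub>r)\<close> of the coordinate ring of \<open>V\<close>.\<close>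

definition generates_invariants ::
  "('k::field ^ 'n::finite ^ 'n) set \<Rightarrow> ('k ^ 'n) set \<Rightarrow> ('r::finite \<Rightarrow> ('n, 'k) mpoly) \<Rightarrow> bool" where
  "generates_invariants G V \<gamma> \<longleftrightarrow>
     (\<forall>i. regf V (\<gamma> i) \<in> invariant_ring G V) \<and>
     (\<forall>\<phi>\<in>invariant_ring G V. \<exists>q. \<phi> = pullback V \<gamma> (peval q))"

definition relation_ideal ::
  "('k::field ^ 'n::finite) set \<Rightarrow> ('r::finite \<Rightarrow> ('n, 'k) mpoly) \<Rightarrow> ('r, 'k) mpoly set" where
  "relation_ideal V \<gamma> = {q. pullback V \<gamma> (peval q) = regf V 0}"

text \<open>So the coordinate ring of \<open>zero_set (relation_ideal V \<gamma>)\<close> is the polynomial ring modulo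
  \<open>relation_ideal V \<gamma>\<close>, by \<open>regf_eq_iff_diff\<close>.\<close>

lemma vanishing_ideal_zero_set_relation_ideal:
  "vanishing_ideal (zero_set (relation_ideal V \<gamma>)) = relation_ideal V \<gamma>"
proof -
  have rel: "q \<in> relation_ideal V \<gamma> \<longleftrightarrow> (\<forall>x\<in>V. peval q (hilbert_map \<gamma> x) = 0)" for q
    unfolding relation_ideal_def pullback_def regf_def mem_Collect_eq
    by (auto simp: peval_def meval_def fun_eq_iff restrict_def)
  then have img: "hilbert_map \<gamma> x \<in> zero_set (relation_ideal V \<gamma>)" if "x \<in> V" for x
    using that by (auto simp: zero_set_def)
  show ?thesis
  proof
    show "vanishing_ideal (zero_set (relation_ideal V \<gamma>)) \<subseteq> relation_ideal V \<gamma>"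
      using img by (auto simp: vanishing_ideal_def rel)
    show "relation_ideal V \<gamma> \<subseteq> vanishing_ideal (zero_set (relation_ideal V \<gamma>))"
      by (auto simp: vanishing_ideal_def zero_set_def)
  qed
qed

text \<open>A bracket is a function on all pairs; only its values on the coordinate ring matter.\<close>

type_synonym ('k, 'n) bracket = "('k ^ 'n \<Rightarrow> 'k) \<Rightarrow> ('k ^ 'n \<Rightarrow> 'k) \<Rightarrow> 'k ^ 'n \<Rightarrow> 'k"

definition poisson_bracket :: "('k::field ^ 'n::finite) set \<Rightarrow> ('k, 'n) bracket \<Rightarrow> bool" where
  "poisson_bracket V B \<longleftrightarrow>
     (\<forall>\<phi>\<in>coord_ring V. \<forall>\<psi>\<in>coord_ring V. B \<phi> \<psi> \<in> coord_ring V) \<and>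
     (\<forall>\<phi>\<in>coord_ring V. \<forall>\<psi>\<in>coord_ring V. B \<phi> \<psi> = (\<lambda>x\<in>V. - B \<psi> \<phi> x)) \<and>
     (\<forall>\<phi>\<in>coord_ring V. \<forall>\<psi>\<in>coord_ring V. \<forall>\<eta>\<in>coord_ring V. \<forall>s t.
        B (\<lambda>x\<in>V. s * \<phi> x + t * \<psi> x) \<eta> = (\<lambda>x\<in>V. s * B \<phi> \<eta> x + t * B \<psi> \<eta> x) \<and>
        B \<eta> (\<lambda>x\<in>V. s * \<phi> x + t * \<psi> x) = (\<lambda>x\<in>V. s * B \<eta> \<phi> x + t * B \<eta> \<psi> x)) \<and>
     (\<forall>\<phi>\<in>coord_ring V. \<forall>\<psi>\<in>coord_ring V. \<forall>\<eta>\<in>coord_ring V.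
        B (\<lambda>x\<in>V. \<phi> x * \<psi> x) \<eta> = (\<lambda>x\<in>V. \<phi> x * B \<psi> \<eta> x + B \<phi> \<eta> x * \<psi> x)) \<and>
     (\<forall>\<phi>\<in>coord_ring V. \<forall>\<psi>\<in>coord_ring V. \<forall>\<eta>\<in>coord_ring V. \<forall>x\<in>V.
        B \<phi> (B \<psi> \<eta>) x + B \<psi> (B \<eta> \<phi>) x + B \<eta> (B \<phi> \<psi>) x = 0)"

definition invariant_bracket ::
  "('k::field ^ 'n::finite ^ 'n) set \<Rightarrow> ('k ^ 'n) set \<Rightarrow> ('k, 'n) bracket \<Rightarrow> bool" where
  "invariant_bracket G V B \<longleftrightarrow>
     (\<forall>T\<in>G. \<forall>\<phi>\<in>coord_ring V. \<forall>\<psi>\<in>coord_ring V.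
        B (act V T \<phi>) (act V T \<psi>) = act V T (B \<phi> \<psi>))"

definition casimir :: "('k::field ^ 'n::finite) set \<Rightarrow> ('k, 'n) bracket \<Rightarrow> ('k ^ 'n \<Rightarrow> 'k) \<Rightarrow> bool" where
  "casimir V B \<phi> \<longleftrightarrow> \<phi> \<in> coord_ring V \<and> (\<forall>\<psi>\<in>coord_ring V. B \<phi> \<psi> = regf V 0)"

definition induced_bracket ::
  "('k::field ^ 'n::finite) set \<Rightarrow> ('r::finite \<Rightarrow> ('n, 'k) mpoly) \<Rightarrow> ('k ^ 'r) set \<Rightarrow>
   ('k, 'n) bracket \<Rightarrow> ('k, 'r) bracket" where
  "induced_bracket V \<gamma> Y B a b =
     (THE c. c \<in> coord_ring Y \<and> B (pullback V \<gamma> a) (pullback V \<gamma> b) = pullback V \<gamma> c)"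

text \<open>
  Vector fields are tuples of polynomials, understood modulo \<open>vanishing_ideal V\<close> in each
  component.
\<close>

definition vector_field_on :: "('k::field ^ 'n::finite) set \<Rightarrow> ('n \<Rightarrow> ('n, 'k) mpoly) \<Rightarrow> bool" where
  "vector_field_on V f \<longleftrightarrow>
     (\<forall>p\<in>vanishing_ideal V. (\<Sum>i\<in>UNIV. f i * mderiv i p) \<in> vanishing_ideal V)"

definition equivariant_field ::
  "('k::field ^ 'n::finite ^ 'n) set \<Rightarrow> ('k ^ 'n) set \<Rightarrow> ('n \<Rightarrow> ('n, 'k) mpoly) \<Rightarrow> bool" where
  "equivariant_field G V f \<longleftrightarrow> vector_field_on V f \<and>
     (\<forall>T\<in>G. \<forall>y\<in>V. T *v (\<chi> i. peval (f i) y) = (\<chi> i. peval (f i) (T *v y)))"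

text \<open>
  \<open>f\<close> is the Hamiltonian vector field of \<open>\<phi>\<close>, for lifts \<open>p\<close> of \<open>\<phi>\<close> and \<open>c i j\<close> of the
  brackets of the coordinate functions.  It depends on \<open>\<phi>\<close> only modulo Casimir elements.
  If it is \<open>G\<close>-equivariant, \<open>\<phi>\<close> is in general only invariant modulo Casimir elements, and
  there need not be an invariant Hamiltonian: take the translations \<open>x\<^sub>1 \<mapsto> x\<^sub>1 + t\<close> of the
  plane (linear on \<open>x\<^sub>3 = 1\<close> in 3-space) with bracket \<open>{x\<^sub>1, x\<^sub>2} = 1\<close> and \<open>\<phi> = x\<^sub>1\<close>.  Its
  Hamiltonian field is sent to \<open>d/dx\<^sub>2\<close> on the line, where the induced bracket is zero and
  only the zero field is Hamiltonian.  Hence invariance of the Hamiltonian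
  has to be required when such a field is pushed to the quotient.
\<close>

definition hamiltonian_field ::
  "('k::field ^ 'n::finite) set \<Rightarrow> ('k, 'n) bracket \<Rightarrow> ('k ^ 'n \<Rightarrow> 'k) \<Rightarrow> ('n \<Rightarrow> ('n, 'k) mpoly) \<Rightarrow> bool" where
  "hamiltonian_field V B \<phi> f \<longleftrightarrow>
     (\<exists>p c. regf V p = \<phi> \<and>
        (\<forall>i j. regf V (c i j) = B (regf V (mvar i)) (regf V (mvar j))) \<and>
        (\<forall>j. f j - (\<Sum>i\<in>UNIV. c i j * mderiv i p) \<in> vanishing_ideal V))"

definition sends_field ::
  "('k::field ^ 'n::finite) set \<Rightarrow> ('r::finite \<Rightarrow> ('n, 'k) mpoly) \<Rightarrow> ('k ^ 'r) set \<Rightarrow>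
   ('n \<Rightarrow> ('n, 'k) mpoly) \<Rightarrow> ('r \<Rightarrow> ('r, 'k) mpoly) \<Rightarrow> bool" where
  "sends_field V \<gamma> Y f g \<longleftrightarrow> vector_field_on V f \<and> vector_field_on Y g \<and>
     (\<forall>x\<in>V. (\<chi> i j. peval (mderiv j (\<gamma> i)) x) *v (\<chi> j. peval (f j) x)
        = (\<chi> i. peval (g i) (hilbert_map \<gamma> x)))"

end

theory Submission
  imports Defs
begin

text \<open>
  Everything rests on one fact: pulling back along the Hilbert map is an isomorphism of
  algebras from the coordinate ring of \<open>Y\<close> onto the ring of invariants.  It is injective because
  the relation ideal is the vanishing ideal of \<open>Y\<close> (\<open>pullback_inj\<close>), its values are invariant
  polynomial functions because each generator is one (\<open>pullback_invariant\<close>), and it is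
  surjective because the generators generate (\<open>invariant_pullback\<close>).

  An invariant bracket of invariants is invariant (\<open>bracket_invariant\<close>), so it has a unique
  preimage under this isomorphism.  This is part (a); the induced bracket is therefore the
  restriction of the original bracket to the invariants, transported to \<open>Y\<close>.  Skew-symmetry,
  bilinearity, the Leibniz rule and the Jacobi identity are equations between regular
  functions, so they can be checked after pulling back (\<open>poisson_induced\<close>).  A Casimir element
  commutes with all regular functions, in particular with the invariant ones
  (\<open>casimir_induced\<close>).

  For Hamiltonian fields the link between the algebraic bracket and the partial derivatives of
  polynomials is the chain rule for derivations of a coordinate ring
  (\<open>derivation_chain_rule\<close>).  Applied in both slots, it shows that the Lie derivative along
  the Hamiltonian field of \<open>\<phi>\<close> is \<open>{\<phi>, _}\<close> (\<open>hamiltonian_field_lie_derivative\<close>).  If \<open>\<phi>\<close> is the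
  pullback of \<open>a\<close>, the \<open>i\<close>-th component of the image of its field under the derivative of the
  Hilbert map is thus \<open>{\<phi>, \<gamma>\<^sub>i}\<close>.  Since \<open>\<gamma>\<^sub>i\<close> is the pullback of the \<open>i\<close>-th coordinate
  \<open>y\<^sub>i\<close> of \<open>Y\<close>, this is the pullback of \<open>{a, y\<^sub>i}'\<close>, which is the \<open>i\<close>-th component of any
  Hamiltonian field of \<open>a\<close> (\<open>hamiltonian_field_sent\<close>).
\<close>

section \<open>Polynomials: evaluation, differentiation, induction\<close>

lemma mpoly_induct_monomial [case_names zero add]:
  fixes p :: "('v, 'a::comm_ring_1) mpoly"
  assumes zero: "P 0"
    and add: "\<And>m c p. P p \<Longrightarrow> P (Poly_Mapping.single m c + p)"
  shows "P p"
proof (induction p rule: update_induct)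
  case const
  show ?case by (rule zero)
next
  case (update p m c)
  have "Poly_Mapping.update m c p = Poly_Mapping.single m c + p"
    using update(1)
    by (intro poly_mapping_eqI)
      (auto simp: lookup_update lookup_add lookup_single in_keys_iff when_def)
  then show ?case using add[OF update(3)] by simp
qed

text \<open>
  Built from constants by adding and by multiplying with a single variable: with this form, a
  rule for \<open>mderiv\<close> of \<open>mvar i * p\<close> replaces the general product rule.
\<close>

lemma mpoly_induct [case_names const mvar add]:
  fixes p :: "('v, 'a::comm_ring_1) mpoly"
  assumes const: "\<And>c. P (Poly_Mapping.single 0 c)"
    and mvar: "\<And>i p. P p \<Longrightarrow> P (mvar i * p)"
    and add: "\<And>p q. P p \<Longrightarrow> P q \<Longrightarrow> P (p + q)"
  shows "P p"
proof -
  have power: "P (Poly_Mapping.single (Poly_Mapping.single i k + m) c)"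
    if "P (Poly_Mapping.single m c)" for i k m c
  proof (induction k)
    case 0
    then show ?case using that by simp
  next
    case (Suc k)
    have "Poly_Mapping.single (Poly_Mapping.single i (Suc k) + m) c
        = mvar i * Poly_Mapping.single (Poly_Mapping.single i k + m) c"
      by (simp add: mvar_def mult_single flip: add.assoc single_add)
    then show ?case using mvar[OF Suc.IH] by simp
  qed
  have monomial: "P (Poly_Mapping.single m c)" for m c
  proof (induction m rule: update_induct)
    case const
    then show ?case by (rule assms(1))
  next
    case (update m i k)
    have "Poly_Mapping.update i k m = Poly_Mapping.single i k + m"
      using update(1)
      by (intro poly_mapping_eqI)
        (auto simp: lookup_update lookup_add lookup_single in_keys_iff when_def)
    then show ?case using power[OF update(3)] by simp
  qed
  show ?thesis
  proof (induction p rule: mpoly_induct_monomial)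
    case zero
    show ?case using monomial[of 0 0] by simp
  next
    case (add m c p)
    then show ?case using assms(3)[OF monomial] by simp
  qed
qed

lemma meval_add: "meval (p + q) x = meval p x + meval q x"
  unfolding meval_def
  by (rule setsum_keys_plus_distrib) (simp_all add: algebra_simps)

lemma meval_single:
  fixes x :: "'v::finite \<Rightarrow> 'a::comm_ring_1"
  shows "meval (Poly_Mapping.single m c) x = c * (\<Prod>i\<in>UNIV. x i ^ Poly_Mapping.lookup m i)"
proof -
  have "(\<Prod>i\<in>Poly_Mapping.keys m. x i ^ Poly_Mapping.lookup m i)
      = (\<Prod>i\<in>UNIV. x i ^ Poly_Mapping.lookup m i)"
    by (rule prod.mono_neutral_left) (auto simp: in_keys_iff)
  then show ?thesis by (simp add: meval_def)
qed

lemma meval_const: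
  fixes x :: "'v::finite \<Rightarrow> 'a::comm_ring_1"
  shows "meval (Poly_Mapping.single 0 c) x = c"
  by (simp add: meval_single)

lemma meval_mvar:
  fixes x :: "'v::finite \<Rightarrow> 'a::comm_ring_1"
  shows "meval (mvar i) x = x i"
proof -
  have "(\<Prod>j\<in>UNIV. x j ^ Poly_Mapping.lookup (Poly_Mapping.single i 1) j)
      = (\<Prod>j\<in>UNIV. if j = i then x j else 1)"
    by (rule prod.cong) (auto simp: lookup_single when_def)
  then show ?thesis by (simp add: mvar_def meval_single)
qed

lemma meval_mult:
  fixes x :: "'v::finite \<Rightarrow> 'a::comm_ring_1"
  shows "meval (p * q) x = meval p x * meval q x"
proof (induction p rule: mpoly_induct_monomial)
  case zero
  then show ?case by (simp add: meval_def)
next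
  case (add m c p)
  have "meval (Poly_Mapping.single m c * q) x = meval (Poly_Mapping.single m c) x * meval q x"
  proof (induction q rule: mpoly_induct_monomial)
    case zero
    then show ?case by (simp add: meval_def)
  next
    case (add n d q)
    then show ?case
      by (simp add: distrib_left meval_add mult_single meval_single lookup_add power_add
          prod.distrib algebra_simps)
  qed
  with add show ?case by (simp add: distrib_right meval_add)
qed

lemma mderiv_add: "mderiv i (p + q) = mderiv i p + mderiv i q"
  unfolding mderiv_def
  by (rule setsum_keys_plus_distrib) (simp_all add: distrib_right single_add)

lemma mderiv_single:
  "mderiv i (Poly_Mapping.single m c)
     = Poly_Mapping.single (m - Poly_Mapping.single i 1) (c * of_nat (Poly_Mapping.lookup m i))"
  by (simp add: mderiv_def)

lemma mderiv_const: "mderiv i (Poly_Mapping.single 0 c) = 0"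
  by (simp add: mderiv_single)

text \<open>
  Exponents are subtracted in \<open>nat\<close>, so for a monomial without the variable \<open>i\<close> lowering the
  exponent and raising it again is not the identity; the coefficient is zero in that case.
\<close>

lemma mderiv_mvar_mult:
  "mderiv k (mvar i * p) = (if k = i then p else 0) + mvar i * mderiv k p"
proof (induction p rule: mpoly_induct_monomial)
  case zero
  then show ?case by (simp add: mderiv_def)
next
  case (add m c p)
  have "mderiv k (mvar i * Poly_Mapping.single m c)
      = (if k = i then Poly_Mapping.single m c else 0) + mvar i * mderiv k (Poly_Mapping.single m c)"
  proof (cases "k = i")
    case False
    then have "Poly_Mapping.single i 1 + m - Poly_Mapping.single k 1
        = Poly_Mapping.single i 1 + (m - Poly_Mapping.single k 1)"
      by (intro poly_mapping_eqI) (auto simp: lookup_add lookup_minus lookup_single when_def)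
    with False show ?thesis
      by (simp add: mvar_def mult_single mderiv_single lookup_add lookup_single)
  next
    case True
    show ?thesis
    proof (cases "Poly_Mapping.lookup m i = 0")
      case zero: True
      with True show ?thesis
        by (simp add: mvar_def mult_single mderiv_single lookup_add)
    next
      case False
      then have "Poly_Mapping.single i 1 + (m - Poly_Mapping.single i 1) = m"
        by (intro poly_mapping_eqI) (auto simp: lookup_add lookup_minus lookup_single when_def)
      with True show ?thesis
        by (simp add: mvar_def mult_single mderiv_single lookup_add distrib_left flip: single_add)
    qed
  qed
  with add show ?case by (simp add: distrib_left mderiv_add algebra_simps)
qed

lemma peval_add: "peval (p + q) x = peval p x + peval q x"
  by (simp add: peval_def meval_add)

lemma peval_mult: "peval (p * q) x = peval p x * peval q x"
  by (simp add: peval_def meval_mult)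

lemma peval_const: "peval (Poly_Mapping.single 0 c) x = c"
  by (simp add: peval_def meval_const)

lemma peval_0: "peval 0 x = 0"
  using peval_const[of 0 x] by simp

lemma peval_1: "peval 1 x = 1"
  using peval_const[of 1 x] by simp

lemma peval_mvar: "peval (mvar i) x = x $ i"
  by (simp add: peval_def meval_mvar)

lemma peval_sum: "peval (\<Sum>i\<in>A. p i) x = (\<Sum>i\<in>A. peval (p i) x)"
  by (induction A rule: infinite_finite_induct) (simp_all add: peval_0 peval_add)

lemma peval_diff: "peval (p - q) x = peval p x - peval q x"
  using peval_add[of "p - q" q x] by simp

section \<open>Derivations of a coordinate ring\<close>

lemma coord_ring_regf: "regf V p \<in> coord_ring V"
  by (simp add: coord_ring_def)

lemma coord_ring_lincomb:
  assumes "\<phi> \<in> coord_ring V" "\<psi> \<in> coord_ring V"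
  shows "(\<lambda>x\<in>V. s * \<phi> x + t * \<psi> x) \<in> coord_ring V"
proof -
  obtain p q where "\<phi> = regf V p" "\<psi> = regf V q"
    using assms by (auto simp: coord_ring_def)
  then have "(\<lambda>x\<in>V. s * \<phi> x + t * \<psi> x)
      = regf V (Poly_Mapping.single 0 s * p + Poly_Mapping.single 0 t * q)"
    by (auto simp: regf_def peval_add peval_mult peval_const)
  then show ?thesis by (simp add: coord_ring_regf)
qed

lemma coord_ring_mult:
  assumes "\<phi> \<in> coord_ring V" "\<psi> \<in> coord_ring V"
  shows "(\<lambda>x\<in>V. \<phi> x * \<psi> x) \<in> coord_ring V"
proof -
  obtain p q where "\<phi> = regf V p" "\<psi> = regf V q"
    using assms by (auto simp: coord_ring_def)
  then have "(\<lambda>x\<in>V. \<phi> x * \<psi> x) = regf V (p * q)"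
    by (auto simp: regf_def peval_mult)
  then show ?thesis by (simp add: coord_ring_regf)
qed

text \<open>
  A derivation is determined by its values on the coordinate functions, since both sides are
  linear, kill constants and obey the same rule for multiplication with a variable.  Linearity
  and the Leibniz rule are stated for restricted functions, so that the two slots of a Poisson
  bracket are instances.
\<close>

lemma derivation_chain_rule:
  fixes D :: "('k::field ^ 'n::finite \<Rightarrow> 'k) \<Rightarrow> 'k ^ 'n \<Rightarrow> 'k"
  assumes linear: "\<And>\<phi> \<psi> s t. \<phi> \<in> coord_ring V \<Longrightarrow> \<psi> \<in> coord_ring V \<Longrightarrow>
      D (\<lambda>x\<in>V. s * \<phi> x + t * \<psi> x) = (\<lambda>x\<in>V. s * D \<phi> x + t * D \<psi> x)"
    and leibniz: "\<And>\<phi> \<psi>. \<phi> \<in> coord_ring V \<Longrightarrow> \<psi> \<in> coord_ring V \<Longrightarrow>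
      D (\<lambda>x\<in>V. \<phi> x * \<psi> x) = (\<lambda>x\<in>V. \<phi> x * D \<psi> x + D \<phi> x * \<psi> x)"
    and x: "x \<in> V"
  shows "D (regf V p) x = (\<Sum>i\<in>UNIV. D (regf V (mvar i)) x * peval (mderiv i p) x)"
proof (induction p rule: mpoly_induct)
  case (const c)
  \<comment> \<open>constants are killed: \<open>D 1 = D (1 * 1) = D 1 + D 1\<close>\<close>
  have square: "(\<lambda>x\<in>V. regf V 1 x * regf V 1 x) = regf V 1"
    by (auto simp: regf_def peval_1)
  have "D (regf V 1) x = regf V 1 x * D (regf V 1) x + D (regf V 1) x * regf V 1 x"
    using fun_cong[OF leibniz[OF coord_ring_regf coord_ring_regf, of 1 1], of x] x
    by (simp only: square restrict_apply')
  then have "D (regf V 1) x = D (regf V 1) x + D (regf V 1) x"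
    using x by (simp only: regf_def peval_1 restrict_apply' mult_1_left mult_1_right)
  then have "D (regf V 1) x = 0"
    by (metis add_cancel_left_right)
  moreover have "regf V (Poly_Mapping.single 0 c) = (\<lambda>x\<in>V. c * regf V 1 x + 0 * regf V 1 x)"
    by (auto simp: regf_def peval_1 peval_const)
  ultimately have "D (regf V (Poly_Mapping.single 0 c)) x = 0"
    using linear[OF coord_ring_regf coord_ring_regf, of c 1 0 1] x by simp
  then show ?case by (simp add: mderiv_const peval_0)
next
  case (mvar k p)
  have "regf V (mvar k * p) = (\<lambda>x\<in>V. regf V (mvar k) x * regf V p x)"
    by (auto simp: regf_def peval_mult)
  then have "D (regf V (mvar k * p)) x
      = peval (mvar k) x * D (regf V p) x + D (regf V (mvar k)) x * peval p x"
    using x by (simp add: leibniz coord_ring_regf) (simp add: regf_def)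
  moreover have "D (regf V (mvar i)) x * peval (mderiv i (mvar k * p)) x
      = peval (mvar k) x * (D (regf V (mvar i)) x * peval (mderiv i p) x)
        + (if i = k then D (regf V (mvar i)) x * peval p x else 0)" for i
    by (simp add: mderiv_mvar_mult peval_add peval_mult peval_0 distrib_left mult.left_commute)
  ultimately show ?case
    by (simp add: mvar.IH sum.distrib sum_distrib_left)
next
  case (add p q)
  have "regf V (p + q) = (\<lambda>x\<in>V. 1 * regf V p x + 1 * regf V q x)"
    by (auto simp: regf_def peval_add)
  then have "D (regf V (p + q)) x = D (regf V p) x + D (regf V q) x"
    using x by (simp add: linear[where s = 1 and t = 1, simplified] coord_ring_regf)
  with add show ?case
    by (simp add: mderiv_add peval_add sum.distrib algebra_simps)
qed

section \<open>Poisson brackets and Hamiltonian vector fields\<close>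

lemma poisson_bracketD:
  assumes "poisson_bracket V B" "\<phi> \<in> coord_ring V" "\<psi> \<in> coord_ring V"
  shows poisson_closed: "B \<phi> \<psi> \<in> coord_ring V"
    and poisson_skew: "B \<phi> \<psi> = (\<lambda>x\<in>V. - B \<psi> \<phi> x)"
  using assms unfolding poisson_bracket_def by blast+

lemma poisson_bracketD3:
  assumes "poisson_bracket V B" "\<phi> \<in> coord_ring V" "\<psi> \<in> coord_ring V" "\<eta> \<in> coord_ring V"
  shows poisson_linear: "B (\<lambda>x\<in>V. s * \<phi> x + t * \<psi> x) \<eta> = (\<lambda>x\<in>V. s * B \<phi> \<eta> x + t * B \<psi> \<eta> x)"
    and poisson_linear2: "B \<eta> (\<lambda>x\<in>V. s * \<phi> x + t * \<psi> x) = (\<lambda>x\<in>V. s * B \<eta> \<phi> x + t * B \<eta> \<psi> x)"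
    and poisson_leibniz: "B (\<lambda>x\<in>V. \<phi> x * \<psi> x) \<eta> = (\<lambda>x\<in>V. \<phi> x * B \<psi> \<eta> x + B \<phi> \<eta> x * \<psi> x)"
    and poisson_jacobi: "x \<in> V \<Longrightarrow> B \<phi> (B \<psi> \<eta>) x + B \<psi> (B \<eta> \<phi>) x + B \<eta> (B \<phi> \<psi>) x = 0"
  using assms unfolding poisson_bracket_def by blast+

lemma poisson_chain_rule:
  assumes B: "poisson_bracket V B" and \<eta>: "\<eta> \<in> coord_ring V" and x: "x \<in> V"
  shows "B (regf V p) \<eta> x = (\<Sum>i\<in>UNIV. B (regf V (mvar i)) \<eta> x * peval (mderiv i p) x)"
  by (rule derivation_chain_rule[where D = "\<lambda>\<phi>. B \<phi> \<eta>", OF _ _ x])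
    (simp_all only: poisson_linear[OF B _ _ \<eta>] poisson_leibniz[OF B _ _ \<eta>])

lemma poisson_chain_rule2:
  assumes B: "poisson_bracket V B" and \<eta>: "\<eta> \<in> coord_ring V" and x: "x \<in> V"
  shows "B \<eta> (regf V p) x = (\<Sum>i\<in>UNIV. B \<eta> (regf V (mvar i)) x * peval (mderiv i p) x)"
proof -
  have skew: "B \<eta> (regf V q) x = - B (regf V q) \<eta> x" for q
    using poisson_skew[OF B \<eta> coord_ring_regf, of q] x by (metis restrict_apply')
  show ?thesis
    by (simp add: skew poisson_chain_rule[OF B \<eta> x, of p] sum_negf)
qed

text \<open>
  The chain rule in the first slot makes the components independent of the chosen lifts.
\<close>

lemma hamiltonian_field_component:
  assumes B: "poisson_bracket V B" and f: "hamiltonian_field V B \<phi> f" and x: "x \<in> V"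
  shows "peval (f j) x = B \<phi> (regf V (mvar j)) x"
proof -
  obtain p c where p: "regf V p = \<phi>"
    and c: "\<And>i j. regf V (c i j) = B (regf V (mvar i)) (regf V (mvar j))"
    and fj: "f j - (\<Sum>i\<in>UNIV. c i j * mderiv i p) \<in> vanishing_ideal V"
    using f unfolding hamiltonian_field_def by blast
  have c': "peval (c i j) x = B (regf V (mvar i)) (regf V (mvar j)) x" for i
    using c[of i j] x by (metis regf_def restrict_apply')
  have "peval (f j) x = (\<Sum>i\<in>UNIV. peval (c i j) x * peval (mderiv i p) x)"
    using fj x by (simp add: vanishing_ideal_def peval_diff peval_sum peval_mult)
  also have "\<dots> = B \<phi> (regf V (mvar j)) x"
    using poisson_chain_rule[OF B coord_ring_regf x, of p "mvar j"] by (simp add: c' p)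
  finally show ?thesis .
qed

lemma hamiltonian_field_lie_derivative:
  assumes B: "poisson_bracket V B" and f: "hamiltonian_field V B \<phi> f" and x: "x \<in> V"
  shows "(\<Sum>j\<in>UNIV. peval (f j) x * peval (mderiv j q) x) = B \<phi> (regf V q) x"
proof -
  have "\<phi> \<in> coord_ring V"
    using f coord_ring_regf unfolding hamiltonian_field_def by blast
  then show ?thesis
    by (simp add: hamiltonian_field_component[OF B f x] poisson_chain_rule2[OF B _ x])
qed

text \<open>
  The Lie derivative of a polynomial \<open>q\<close> vanishing on \<open>V\<close> is \<open>B \<phi> 0\<close>, which is zero by linearity.
\<close>

lemma hamiltonian_field_vector_field:
  assumes B: "poisson_bracket V B" and f: "hamiltonian_field V B \<phi> f"
  shows "vector_field_on V f"
  unfolding vector_field_on_def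
proof
  fix q assume q: "q \<in> vanishing_ideal V"
  have \<phi>: "\<phi> \<in> coord_ring V"
    using f coord_ring_regf unfolding hamiltonian_field_def by blast
  \<comment> \<open>the zero function as a linear combination, so that linearity applies to it\<close>
  have "regf V q = (\<lambda>x\<in>V. 0 * \<phi> x + 0 * \<phi> x)"
    using q by (auto simp: regf_def vanishing_ideal_def)
  then have "B \<phi> (regf V q) x = 0" if "x \<in> V" for x
    using that by (simp add: poisson_linear2[OF B \<phi> \<phi> \<phi>, of 0 0, simplified])
  then show "(\<Sum>j\<in>UNIV. f j * mderiv j q) \<in> vanishing_ideal V"
    by (simp add: vanishing_ideal_def peval_sum peval_mult
        hamiltonian_field_lie_derivative[OF B f])
qed

lemma hamiltonian_field_exists:
  assumes B: "poisson_bracket V B" and \<phi>: "\<phi> \<in> coord_ring V"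
  obtains f where "hamiltonian_field V B \<phi> f"
proof -
  obtain p where p: "regf V p = \<phi>"
    using \<phi> by (auto simp: coord_ring_def)
  have "\<exists>c. regf V c = B (regf V (mvar i)) (regf V (mvar j))" for i j
    using poisson_closed[OF B coord_ring_regf coord_ring_regf, of "mvar i" "mvar j"]
    by (auto simp: coord_ring_def)
  then obtain c where "\<And>i j. regf V (c i j) = B (regf V (mvar i)) (regf V (mvar j))"
    by metis
  with p have "hamiltonian_field V B \<phi> (\<lambda>j. \<Sum>i\<in>UNIV. c i j * mderiv i p)"
    unfolding hamiltonian_field_def by (intro exI[of _ p] exI[of _ c]) (simp add: vanishing_ideal_def peval_0)
  then show ?thesis by (rule that)
qed

section \<open>The Hilbert map identifies the coordinate ring of the image with the invariants\<close>

lemma relation_ideal_iff: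
  "q \<in> relation_ideal V \<gamma> \<longleftrightarrow> (\<forall>x\<in>V. peval q (hilbert_map \<gamma> x) = 0)"
  unfolding relation_ideal_def pullback_def regf_def
  by (auto simp: peval_0 fun_eq_iff restrict_def)

lemma hilbert_map_image:
  "x \<in> V \<Longrightarrow> hilbert_map \<gamma> x \<in> zero_set (relation_ideal V \<gamma>)"
  by (auto simp: zero_set_def relation_ideal_iff)

lemma pullback_regf:
  "pullback V \<gamma> (regf (zero_set (relation_ideal V \<gamma>)) q) = pullback V \<gamma> (peval q)"
  by (auto simp: pullback_def regf_def hilbert_map_image)

lemma pullback_restrict:
  "pullback V \<gamma> (\<lambda>y\<in>zero_set (relation_ideal V \<gamma>). F y) = (\<lambda>x\<in>V. F (hilbert_map \<gamma> x))"
  by (auto simp: pullback_def hilbert_map_image)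

lemma pullback_apply: "x \<in> V \<Longrightarrow> pullback V \<gamma> a x = a (hilbert_map \<gamma> x)"
  by (simp add: pullback_def)

text \<open>
  Two polynomials that agree on the image of the Hilbert map differ by a relation, and
  relations vanish on all of \<open>Y\<close>.
\<close>

lemma pullback_inj:
  fixes V :: "('k::field ^ 'n::finite) set" and \<gamma> :: "'r::finite \<Rightarrow> ('n, 'k) mpoly"
  assumes "pullback V \<gamma> a = pullback V \<gamma> b"
    and "a \<in> coord_ring (zero_set (relation_ideal V \<gamma>))"
    and "b \<in> coord_ring (zero_set (relation_ideal V \<gamma>))"
  shows "a = b"
proof -
  let ?Y = "zero_set (relation_ideal V \<gamma>)"
  obtain p q where ab: "a = regf ?Y p" "b = regf ?Y q"
    using assms(2,3) by (auto simp: coord_ring_def)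
  have "peval p (hilbert_map \<gamma> x) = peval q (hilbert_map \<gamma> x)" if "x \<in> V" for x
    using fun_cong[OF assms(1), of x] that by (simp add: ab pullback_regf pullback_apply)
  then have "p - q \<in> vanishing_ideal ?Y"
    by (simp add: vanishing_ideal_zero_set_relation_ideal relation_ideal_iff peval_diff)
  then show ?thesis by (simp add: ab regf_eq_iff_diff)
qed

text \<open>Substituting polynomials into a polynomial gives a polynomial.\<close>

lemma peval_hilbert_map: "\<exists>s. \<forall>x. peval s x = peval q (hilbert_map \<gamma> x)"
proof (induction q rule: mpoly_induct)
  case (const c)
  show ?case by (metis peval_const)
next
  case (mvar i p)
  then obtain s where "\<forall>x. peval s x = peval p (hilbert_map \<gamma> x)" ..
  then have "\<forall>x. peval (\<gamma> i * s) x = peval (mvar i * p) (hilbert_map \<gamma> x)"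
    by (simp add: peval_mult peval_mvar hilbert_map_def)
  then show ?case ..
next
  case (add p q)
  then show ?case by (metis peval_add)
qed

context
  fixes G :: "('k::field ^ 'n::finite ^ 'n) set"
    and V :: "('k ^ 'n) set"
    and \<gamma> :: "'r::finite \<Rightarrow> ('n, 'k) mpoly"
    and Y :: "('k ^ 'r) set"
  assumes stable: "\<forall>T\<in>G. (\<lambda>x. T *v x) ` V = V"
    and gen: "generates_invariants G V \<gamma>"
    and Y: "Y = zero_set (relation_ideal V \<gamma>)"
begin

lemma hilbert_map_invariant:
  assumes "T \<in> G" "x \<in> V"
  shows "hilbert_map \<gamma> (T *v x) = hilbert_map \<gamma> x"
proof -
  have Tx: "T *v x \<in> V" using stable assms by blast
  have "act V T (regf V (\<gamma> i)) = regf V (\<gamma> i)" for i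
    using gen assms by (auto simp: generates_invariants_def invariant_ring_def)
  then have "act V T (regf V (\<gamma> i)) x = regf V (\<gamma> i) x" for i
    by simp
  then have "peval (\<gamma> i) (T *v x) = peval (\<gamma> i) x" for i
    using assms Tx by (simp add: act_def regf_def)
  then show ?thesis by (simp add: hilbert_map_def)
qed

lemma pullback_invariant:
  assumes "a \<in> coord_ring Y"
  shows "pullback V \<gamma> a \<in> invariant_ring G V"
proof -
  obtain q where q: "a = regf Y q" using assms by (auto simp: coord_ring_def)
  obtain s where s: "\<forall>x. peval s x = peval q (hilbert_map \<gamma> x)"
    using peval_hilbert_map by blast
  have a: "pullback V \<gamma> a = regf V s"
    unfolding q Y pullback_regf by (auto simp: pullback_def regf_def s)
  have "act V T (pullback V \<gamma> a) = pullback V \<gamma> a" if "T \<in> G" for T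
    using that stable hilbert_map_invariant[OF that]
    by (auto simp: act_def pullback_def fun_eq_iff)
  then show ?thesis by (simp add: invariant_ring_def a coord_ring_regf)
qed

lemma pullback_coord_ring: "a \<in> coord_ring Y \<Longrightarrow> pullback V \<gamma> a \<in> coord_ring V"
  using pullback_invariant by (auto simp: invariant_ring_def)

lemma invariant_pullback:
  assumes "\<phi> \<in> invariant_ring G V"
  obtains a where "a \<in> coord_ring Y" "\<phi> = pullback V \<gamma> a"
proof -
  obtain q where "\<phi> = pullback V \<gamma> (peval q)"
    using gen assms by (auto simp: generates_invariants_def)
  then show ?thesis
    using that[of "regf Y q"] by (simp add: coord_ring_regf Y pullback_regf)
qed

lemma pullback_eq_iff:
  "a \<in> coord_ring Y \<Longrightarrow> b \<in> coord_ring Y \<Longrightarrow> pullback V \<gamma> a = pullback V \<gamma> b \<longleftrightarrow> a = b"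
  using pullback_inj unfolding Y by blast

lemma pullback_coordinate: "pullback V \<gamma> (regf Y (mvar i)) = regf V (\<gamma> i)"
  unfolding Y pullback_regf
  by (auto simp: pullback_def regf_def peval_mvar hilbert_map_def)

lemma pullback_zero: "pullback V \<gamma> (regf Y 0) = regf V 0"
  unfolding Y pullback_regf by (auto simp: pullback_def regf_def peval_0)

section \<open>The induced bracket\<close>

context
  fixes B :: "('k, 'n) bracket"
  assumes B: "poisson_bracket V B"
    and inv: "invariant_bracket G V B"
begin

lemma bracket_invariant:
  assumes "\<phi> \<in> invariant_ring G V" "\<psi> \<in> invariant_ring G V"
  shows "B \<phi> \<psi> \<in> invariant_ring G V"
proof -
  have c: "\<phi> \<in> coord_ring V" "\<psi> \<in> coord_ring V"
    using assms by (auto simp: invariant_ring_def)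
  have "act V T (B \<phi> \<psi>) = B \<phi> \<psi>" if T: "T \<in> G" for T
  proof -
    have "act V T \<phi> = \<phi>" "act V T \<psi> = \<psi>"
      using assms T by (auto simp: invariant_ring_def)
    moreover have "B (act V T \<phi>) (act V T \<psi>) = act V T (B \<phi> \<psi>)"
      using inv T c unfolding invariant_bracket_def by blast
    ultimately show ?thesis by simp
  qed
  then show ?thesis by (simp add: invariant_ring_def poisson_closed[OF B c])
qed

lemma bracket_pullback_ex1:
  assumes "a \<in> coord_ring Y" "b \<in> coord_ring Y"
  shows "\<exists>!c. c \<in> coord_ring Y \<and> B (pullback V \<gamma> a) (pullback V \<gamma> b) = pullback V \<gamma> c"
proof -
  have "B (pullback V \<gamma> a) (pullback V \<gamma> b) \<in> invariant_ring G V"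
    by (intro bracket_invariant pullback_invariant assms)
  then obtain c where "c \<in> coord_ring Y" "B (pullback V \<gamma> a) (pullback V \<gamma> b) = pullback V \<gamma> c"
    by (rule invariant_pullback)
  then show ?thesis by (auto simp: pullback_eq_iff)
qed

abbreviation (input) B' :: "('k, 'r) bracket" where
  "B' \<equiv> induced_bracket V \<gamma> Y B"

lemma induced_bracket:
  assumes "a \<in> coord_ring Y" "b \<in> coord_ring Y"
  shows induced_closed: "B' a b \<in> coord_ring Y"
    and pullback_induced: "pullback V \<gamma> (B' a b) = B (pullback V \<gamma> a) (pullback V \<gamma> b)"
  using theI'[OF bracket_pullback_ex1[OF assms]] unfolding induced_bracket_def by simp_all

lemma pullback_lincomb:
  "pullback V \<gamma> (\<lambda>y\<in>Y. s * a y + t * b y) = (\<lambda>x\<in>V. s * pullback V \<gamma> a x + t * pullback V \<gamma> b x)"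
  unfolding Y pullback_restrict by (auto simp: pullback_apply)

lemma pullback_times:
  "pullback V \<gamma> (\<lambda>y\<in>Y. a y * b y) = (\<lambda>x\<in>V. pullback V \<gamma> a x * pullback V \<gamma> b x)"
  unfolding Y pullback_restrict by (auto simp: pullback_apply)

text \<open>
  Each axiom is an equation between elements of the coordinate ring of \<open>Y\<close>, hence follows from
  its pullback.  To see membership and compute pullbacks, sums and negatives are
  written as linear combinations.
\<close>

lemma poisson_induced: "poisson_bracket Y B'"
proof -
  note closed = induced_closed coord_ring_lincomb coord_ring_mult pullback_coord_ring
  have skew: "B' a b = (\<lambda>y\<in>Y. - B' b a y)" if ab: "a \<in> coord_ring Y" "b \<in> coord_ring Y" for a b
  proof -
    have eq: "(\<lambda>y\<in>Y. - B' b a y) = (\<lambda>y\<in>Y. (-1) * B' b a y + 0 * B' b a y)"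
      by simp
    have "pullback V \<gamma> (B' a b) = pullback V \<gamma> (\<lambda>y\<in>Y. - B' b a y)"
      unfolding eq pullback_lincomb pullback_induced[OF ab] pullback_induced[OF ab(2,1)]
      using poisson_skew[OF B pullback_coord_ring[OF ab(1)] pullback_coord_ring[OF ab(2)]]
      by simp
    moreover have "(\<lambda>y\<in>Y. - B' b a y) \<in> coord_ring Y"
      unfolding eq by (intro closed ab)
    ultimately show ?thesis
      using induced_closed[OF ab] by (simp only: pullback_eq_iff)
  qed
  have linear: "B' (\<lambda>y\<in>Y. s * a y + t * b y) c = (\<lambda>y\<in>Y. s * B' a c y + t * B' b c y)"
    and linear2: "B' c (\<lambda>y\<in>Y. s * a y + t * b y) = (\<lambda>y\<in>Y. s * B' c a y + t * B' c b y)"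
    and leibniz: "B' (\<lambda>y\<in>Y. a y * b y) c = (\<lambda>y\<in>Y. a y * B' b c y + B' a c y * b y)"
    and jacobi: "\<And>y. y \<in> Y \<Longrightarrow> B' a (B' b c) y + B' b (B' c a) y + B' c (B' a b) y = 0"
    if abc: "a \<in> coord_ring Y" "b \<in> coord_ring Y" "c \<in> coord_ring Y" for a b c s t
  proof -
    note pABC = abc[THEN pullback_coord_ring]
    show "B' (\<lambda>y\<in>Y. s * a y + t * b y) c = (\<lambda>y\<in>Y. s * B' a c y + t * B' b c y)"
    proof (rule pullback_eq_iff[THEN iffD1])
      show "pullback V \<gamma> (B' (\<lambda>y\<in>Y. s * a y + t * b y) c)
          = pullback V \<gamma> (\<lambda>y\<in>Y. s * B' a c y + t * B' b c y)"
        by (simp only: pullback_induced closed abc pullback_lincomb poisson_linear[OF B pABC])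
    qed (intro closed abc)+
    show "B' c (\<lambda>y\<in>Y. s * a y + t * b y) = (\<lambda>y\<in>Y. s * B' c a y + t * B' c b y)"
    proof (rule pullback_eq_iff[THEN iffD1])
      show "pullback V \<gamma> (B' c (\<lambda>y\<in>Y. s * a y + t * b y))
          = pullback V \<gamma> (\<lambda>y\<in>Y. s * B' c a y + t * B' c b y)"
        by (simp only: pullback_induced closed abc pullback_lincomb poisson_linear2[OF B pABC])
    qed (intro closed abc)+
    have eq: "(\<lambda>y\<in>Y. a y * B' b c y + B' a c y * b y)
        = (\<lambda>y\<in>Y. 1 * (\<lambda>y\<in>Y. a y * B' b c y) y + 1 * (\<lambda>y\<in>Y. B' a c y * b y) y)"
      by auto
    show "B' (\<lambda>y\<in>Y. a y * b y) c = (\<lambda>y\<in>Y. a y * B' b c y + B' a c y * b y)"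
      unfolding eq
    proof (rule pullback_eq_iff[THEN iffD1])
      have "pullback V \<gamma> (B' (\<lambda>y\<in>Y. a y * b y) c)
          = (\<lambda>x\<in>V. pullback V \<gamma> a x * B (pullback V \<gamma> b) (pullback V \<gamma> c) x
                + B (pullback V \<gamma> a) (pullback V \<gamma> c) x * pullback V \<gamma> b x)"
        by (simp only: pullback_induced closed abc pullback_times poisson_leibniz[OF B pABC])
      also have "\<dots> = pullback V \<gamma>
          (\<lambda>y\<in>Y. 1 * (\<lambda>y\<in>Y. a y * B' b c y) y + 1 * (\<lambda>y\<in>Y. B' a c y * b y) y)"
        unfolding pullback_lincomb pullback_times pullback_induced[OF abc(2,3)]
          pullback_induced[OF abc(1,3)] by auto
      finally show "pullback V \<gamma> (B' (\<lambda>y\<in>Y. a y * b y) c) = \<dots>" .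
    qed (intro closed abc)+
    let ?J = "\<lambda>y\<in>Y. 1 * (\<lambda>y\<in>Y. 1 * B' a (B' b c) y + 1 * B' b (B' c a) y) y
                  + 1 * B' c (B' a b) y"
    have "?J = regf Y 0"
    proof (rule pullback_eq_iff[THEN iffD1])
      have "pullback V \<gamma> ?J = (\<lambda>x\<in>V. 0)"
        unfolding pullback_lincomb
        using poisson_jacobi[OF B pABC]
        by (auto simp: pullback_induced closed abc)
      also have "\<dots> = pullback V \<gamma> (regf Y 0)"
        unfolding pullback_zero by (auto simp: regf_def peval_0)
      finally show "pullback V \<gamma> ?J = pullback V \<gamma> (regf Y 0)" .
    qed (intro closed abc coord_ring_regf)+
    then have J: "?J y = regf Y 0 y" for y
      by (rule fun_cong)
    show "B' a (B' b c) y + B' b (B' c a) y + B' c (B' a b) y = 0" if "y \<in> Y" for y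
      using J[of y] that by (simp add: regf_def peval_0)
  qed
  show ?thesis
    unfolding poisson_bracket_def
  proof (intro conjI ballI allI, goal_cases)
    case 1
    then show ?case by (rule induced_closed)
  next
    case 2
    then show ?case by (rule skew)
  next
    case 3
    then show ?case by (rule linear)
  next
    case 4
    then show ?case by (rule linear2)
  next
    case 5
    then show ?case by (rule leibniz)
  next
    case 6
    then show ?case by (rule jacobi)
  qed
qed

lemma casimir_induced:
  assumes a: "a \<in> coord_ring Y" and cas: "casimir V B (pullback V \<gamma> a)"
  shows "casimir Y B' a"
  unfolding casimir_def
proof (intro conjI ballI a)
  fix b assume b: "b \<in> coord_ring Y"
  have "pullback V \<gamma> (B' a b) = pullback V \<gamma> (regf Y 0)"
    using cas pullback_coord_ring[OF b]
    by (simp add: pullback_induced a b casimir_def pullback_zero)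
  then show "B' a b = regf Y 0"
    by (simp add: pullback_eq_iff induced_closed a b coord_ring_regf)
qed

text \<open>
  At a point of \<open>V\<close>, both sides are the bracket of the Hamiltonian with \<open>\<gamma>\<^sub>i\<close>, computed on
  \<open>V\<close> and on \<open>Y\<close> respectively.
\<close>

lemma hamiltonian_field_sent:
  assumes a: "a \<in> coord_ring Y" and f: "hamiltonian_field V B (pullback V \<gamma> a) f"
    and g: "hamiltonian_field Y B' a g"
  shows "sends_field V \<gamma> Y f g"
proof -
  have "(\<Sum>j\<in>UNIV. peval (mderiv j (\<gamma> i)) x * peval (f j) x) = peval (g i) (hilbert_map \<gamma> x)"
    if x: "x \<in> V" for i x
  proof -
    have "(\<Sum>j\<in>UNIV. peval (mderiv j (\<gamma> i)) x * peval (f j) x)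
        = B (pullback V \<gamma> a) (pullback V \<gamma> (regf Y (mvar i))) x"
      using hamiltonian_field_lie_derivative[OF B f x, of "\<gamma> i"]
      by (simp add: pullback_coordinate mult.commute)
    also have "\<dots> = B' a (regf Y (mvar i)) (hilbert_map \<gamma> x)"
      using x by (simp add: pullback_apply coord_ring_regf a flip: pullback_induced)
    also have "\<dots> = peval (g i) (hilbert_map \<gamma> x)"
      using hamiltonian_field_component[OF poisson_induced g, of "hilbert_map \<gamma> x" i]
        hilbert_map_image[OF x, of \<gamma>]
      unfolding Y by simp
    finally show ?thesis .
  qed
  then show ?thesis
    unfolding sends_field_def
    using hamiltonian_field_vector_field[OF B f] hamiltonian_field_vector_field[OF poisson_induced g]
    by (simp add: matrix_vector_mult_def)
qed

end

end

theorem propositionA5: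
  fixes G :: "('k::real_normed_field ^ 'n::finite ^ 'n) set"
    and V :: "('k ^ 'n) set"
    and \<gamma> :: "'r::finite \<Rightarrow> ('n, 'k) mpoly"
    and Y :: "('k ^ 'r) set"
    and B :: "('k, 'n) bracket"
  assumes "linear_algebraic_group G"
    and "irreducible_variety V"
    and "\<forall>T\<in>G. (\<lambda>x. T *v x) ` V = V"
    and "generates_invariants G V \<gamma>"
    and "Y = zero_set (relation_ideal V \<gamma>)"
    and "poisson_bracket V B"
    and "invariant_bracket G V B"
  shows "(\<forall>\<phi>\<in>invariant_ring G V. \<forall>\<psi>\<in>invariant_ring G V. \<forall>a\<in>coord_ring Y. \<forall>b\<in>coord_ring Y.
            \<phi> = pullback V \<gamma> a \<and> \<psi> = pullback V \<gamma> b \<longrightarrow>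
            (\<exists>!c. c \<in> coord_ring Y \<and> B \<phi> \<psi> = pullback V \<gamma> c)) \<and>
         poisson_bracket Y (induced_bracket V \<gamma> Y B) \<and>
         (\<forall>f. equivariant_field G V f \<and> (\<exists>\<phi>\<in>invariant_ring G V. hamiltonian_field V B \<phi> f) \<longrightarrow>
            (\<exists>g. sends_field V \<gamma> Y f g \<and>
                 (\<exists>a\<in>coord_ring Y. hamiltonian_field Y (induced_bracket V \<gamma> Y B) a g))) \<and>
         (\<forall>\<phi>. \<forall>a\<in>coord_ring Y. casimir V B \<phi> \<and> \<phi> = pullback V \<gamma> a \<longrightarrow>
            casimir Y (induced_bracket V \<gamma> Y B) a)"
proof (intro conjI)
  note quot = assms(3,4,5) and quot_bracket = assms(3,4,5,6,7)
  show "\<forall>\<phi>\<in>invariant_ring G V. \<forall>\<psi>\<in>invariant_ring G V. \<forall>a\<in>coord_ring Y. \<forall>b\<in>coord_ring Y.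
      \<phi> = pullback V \<gamma> a \<and> \<psi> = pullback V \<gamma> b \<longrightarrow>
      (\<exists>!c. c \<in> coord_ring Y \<and> B \<phi> \<psi> = pullback V \<gamma> c)"
    by (intro ballI impI, elim conjE, hypsubst, rule bracket_pullback_ex1[OF quot_bracket])
  show poisson: "poisson_bracket Y (induced_bracket V \<gamma> Y B)"
    by (rule poisson_induced[OF quot_bracket])
  show "\<forall>f. equivariant_field G V f \<and> (\<exists>\<phi>\<in>invariant_ring G V. hamiltonian_field V B \<phi> f) \<longrightarrow>
      (\<exists>g. sends_field V \<gamma> Y f g \<and>
           (\<exists>a\<in>coord_ring Y. hamiltonian_field Y (induced_bracket V \<gamma> Y B) a g))"
  proof (intro allI impI, elim conjE bexE)
    fix f \<phi>
    assume "\<phi> \<in> invariant_ring G V" and f: "hamiltonian_field V B \<phi> f"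
    then obtain a where a: "a \<in> coord_ring Y" "\<phi> = pullback V \<gamma> a"
      using invariant_pullback[OF quot] by blast
    obtain g where g: "hamiltonian_field Y (induced_bracket V \<gamma> Y B) a g"
      using hamiltonian_field_exists[OF poisson a(1)] .
    have "sends_field V \<gamma> Y f g"
      using f unfolding a(2) by (rule hamiltonian_field_sent[OF quot_bracket a(1) _ g])
    with a(1) g show "\<exists>g. sends_field V \<gamma> Y f g \<and>
        (\<exists>a\<in>coord_ring Y. hamiltonian_field Y (induced_bracket V \<gamma> Y B) a g)"
      by blast
  qed
  show "\<forall>\<phi>. \<forall>a\<in>coord_ring Y. casimir V B \<phi> \<and> \<phi> = pullback V \<gamma> a \<longrightarrow>
      casimir Y (induced_bracket V \<gamma> Y B) a"
    by (intro allI ballI impI, elim conjE, hypsubst, rule casimir_induced[OF quot_bracket])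
qed

end
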